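(* Let $k\ge2$ and let $c_l,b_l$ ($l=1,\dots,k$) be respectively the nodes and the weights of the $k$-point Gauss–Legendre quadrature over $[0,1]$. Then, when $A\to0$, the method EFCM($k,k$) for $u'+Au=g(t,u)$, $u(0)=u_0$, reduces to the $k$-stage Gauss method for $u'=g(t,u)$, $u(0)=u_0$ (that is, the coefficients of EFCM($k,k$) tend to those of the $k$-stage Gauss method as $A\to0$).
   Context: Here $g:\mathbb R\times\mathbb R^d\to\mathbb R^d$ is analytic, $u_0\in\mathbb R^d$, and $A$ is a linear operator on $\mathbb R^d$ (a $d\times d$ matrix). The stepsize is $h>0$ and $V:=hA$. Shifted Legendre polynomials: $\widehat P_j(x)=(-1)^j\sqrt{2j+1}\sum_{i=0}^{j}\binom{j}{i}\binom{j+i}{i}(-x)^i$, so that $\int_0^1\widehat P_i\widehat P_j\,dx=\delta_{ij}$. $\varphi$-functions: $\varphi_0(z)=e^z$, $\varphi_i(z)=\int_0^1e^{(1-\sigma)z}\frac{\sigma^{i-1}}{(i-1)!}d\sigma$ for $i\ge1$. For nodes $c_1,\dots,c_k\in[0,1]$ and weights $b_1,\dots,b_k$ of a quadrature formula on $[0,1]$, EFCM($k,n$) (the $k$-stage exponential Fourier collocation method with integer $n$, $2\le n\le k$) is $$v_i=\varphi_0(-c_iV)u_0+c_ih\sum_{l=1}^kb_l\Big(\sum_{j=0}^{n-1}I_{j,c_i}(V)\widehat P_j(c_l)\Big)g(c_lh,v_l),\quad i=1,\dots,k,$$ $$v(h)=\varphi_0(-V)u_0+h\sum_{l=1}^kb_l\Big(\sum_{j=0}^{n-1}I_j(V)\widehat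 P_j(c_l)\Big)g(c_lh,v_l),$$ where $I_j(V)=\int_0^1\widehat P_j(z)e^{-(1-z)V}dz=\sqrt{2j+1}\sum_{i=0}^j(-1)^{j+i}\frac{(j+i)!}{i!(j-i)!}\varphi_{i+1}(-V)$ and $I_{j,c}(V)=\int_0^1\widehat P_j(cz)e^{-(1-z)cV}dz=(-1)^j\sqrt{2j+1}\sum_{i=0}^j(-c)^i\frac{(j+i)!}{i!(j-i)!}\varphi_{i+1}(-cV)$. EFCM($k,k$) is the case $n=k$. The $k$-stage Gauss method is the Runge–Kutta collocation method based on the $k$ Gauss–Legendre nodes of $[0,1]$: $a_{ij}=\int_0^{c_i}\ell_j(\tau)d\tau$, $b_j=\int_0^1\ell_j(\tau)d\tau$, with $\ell_j$ the Lagrange basis polynomials for $c_1,\dots,c_k$. *)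

theory Defs
  imports "HOL-Analysis.Analysis"
begin

(* Multiplication on the type real^'d^'d is componentwise, so neither the library's power nor its exp
   is the one of matrices. *)
definition matrix_power :: "real^'d^'d \<Rightarrow> nat \<Rightarrow> real^'d^'d" where
  "matrix_power Z m = (((**) Z) ^^ m) (mat 1)"

definition matrix_exp :: "real^'d^'d \<Rightarrow> real^'d^'d" where
  "matrix_exp Z = (\<Sum>m. (1 / fact m) *\<^sub>R matrix_power Z m)"

definition phi :: "nat \<Rightarrow> real^'d^'d \<Rightarrow> real^'d^'d" where
  "phi i Z = (if i = 0 then matrix_exp Z
     else integral {0..1} (\<lambda>\<sigma>. (\<sigma> ^ (i - 1) / fact (i - 1)) *\<^sub>R matrix_exp ((1 - \<sigma>) *\<^sub>R Z)))"

(* Normalised in L2[0,1]. *)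
definition shifted_legendre :: "nat \<Rightarrow> real \<Rightarrow> real" where
  "shifted_legendre j x = (-1) ^ j * sqrt (2 * real j + 1) *
     (\<Sum>i=0..j. real (j choose i) * real ((j + i) choose i) * (-x) ^ i)"

definition lagrange_basis :: "nat \<Rightarrow> (nat \<Rightarrow> real) \<Rightarrow> nat \<Rightarrow> real \<Rightarrow> real" where
  "lagrange_basis k c j \<tau> = (\<Prod>m\<in>{1..k} - {j}. (\<tau> - c m) / (c j - c m))"

(* Nodes and weights are indexed by 1..k; the nodes may be listed in any order. *)
definition gauss_legendre_quadrature ::
    "nat \<Rightarrow> (nat \<Rightarrow> real) \<Rightarrow> (nat \<Rightarrow> real) \<Rightarrow> bool" where
  "gauss_legendre_quadrature k c b \<longleftrightarrow>
     inj_on c {1..k} \<and>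
     (\<forall>l\<in>{1..k}. c l \<in> {0..1} \<and> shifted_legendre k (c l) = 0) \<and>
     (\<forall>l\<in>{1..k}. b l = integral {0..1} (lagrange_basis k c l))"

(* Real analyticity on the whole space: near every point the function is the sum of a multi-variable
   power series in the coordinates. Multi-indices are the extensional functions from Basis to nat. *)
definition real_analytic :: "('a::euclidean_space \<Rightarrow> 'b::euclidean_space) \<Rightarrow> bool" where
  "real_analytic f \<longleftrightarrow>
     (\<forall>x. \<exists>r>0. \<exists>a :: ('a \<Rightarrow> nat) \<Rightarrow> 'b. \<forall>y\<in>ball x r.
        ((\<lambda>\<alpha>. (\<Prod>e\<in>Basis. ((y - x) \<bullet> e) ^ \<alpha> e) *\<^sub>R a \<alpha>) has_sum f y) (Basis \<rightarrow>\<^sub>E UNIV))"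


definition I_stage :: "nat \<Rightarrow> real \<Rightarrow> real^'d^'d \<Rightarrow> real^'d^'d" where
  "I_stage j c V =
     integral {0..1} (\<lambda>z. shifted_legendre j (c * z) *\<^sub>R matrix_exp (- ((1 - z) * c) *\<^sub>R V))"

definition I_update :: "nat \<Rightarrow> real^'d^'d \<Rightarrow> real^'d^'d" where
  "I_update j V =
     integral {0..1} (\<lambda>z. shifted_legendre j z *\<^sub>R matrix_exp (- (1 - z) *\<^sub>R V))"

(* Matrix coefficients of h g(c_l h, v_l) in EFCM(k,n): in the i-th stage and in the update. *)
definition efcm_a ::
    "nat \<Rightarrow> (nat \<Rightarrow> real) \<Rightarrow> (nat \<Rightarrow> real) \<Rightarrow> real^'d^'d \<Rightarrow> nat \<Rightarrow> nat \<Rightarrow> real^'d^'d" where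
  "efcm_a n c b V i l =
     (c i * b l) *\<^sub>R (\<Sum>j<n. shifted_legendre j (c l) *\<^sub>R I_stage j (c i) V)"

definition efcm_b ::
    "nat \<Rightarrow> (nat \<Rightarrow> real) \<Rightarrow> (nat \<Rightarrow> real) \<Rightarrow> real^'d^'d \<Rightarrow> nat \<Rightarrow> real^'d^'d" where
  "efcm_b n c b V l = b l *\<^sub>R (\<Sum>j<n. shifted_legendre j (c l) *\<^sub>R I_update j V)"

(* v solves the (implicit) stage equations and u1 = v(h) is the resulting step from u0. *)
definition efcm_step ::
    "nat \<Rightarrow> nat \<Rightarrow> (nat \<Rightarrow> real) \<Rightarrow> (nat \<Rightarrow> real) \<Rightarrow> real \<Rightarrow> real^'d^'d \<Rightarrow>
     (real \<Rightarrow> real^'d \<Rightarrow> real^'d) \<Rightarrow> real^'d \<Rightarrow> (nat \<Rightarrow> real^'d) \<Rightarrow> real^'d \<Rightarrow> bool" where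
  "efcm_step k n c b h A g u0 v u1 \<longleftrightarrow>
     (\<forall>i\<in>{1..k}. v i = phi 0 (- c i *\<^sub>R (h *\<^sub>R A)) *v u0
        + h *\<^sub>R (\<Sum>l=1..k. efcm_a n c b (h *\<^sub>R A) i l *v g (c l * h) (v l))) \<and>
     u1 = phi 0 (- (h *\<^sub>R A)) *v u0
        + h *\<^sub>R (\<Sum>l=1..k. efcm_b n c b (h *\<^sub>R A) l *v g (c l * h) (v l))"


(* Runge-Kutta collocation method with nodes c; for the Gauss-Legendre nodes, the Gauss method. *)
definition collocation_a :: "nat \<Rightarrow> (nat \<Rightarrow> real) \<Rightarrow> nat \<Rightarrow> nat \<Rightarrow> real" where
  "collocation_a k c i j = integral {0..c i} (lagrange_basis k c j)"

definition collocation_b :: "nat \<Rightarrow> (nat \<Rightarrow> real) \<Rightarrow> nat \<Rightarrow> real" where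
  "collocation_b k c j = integral {0..1} (lagrange_basis k c j)"

definition collocation_step ::
    "nat \<Rightarrow> (nat \<Rightarrow> real) \<Rightarrow> real \<Rightarrow>
     (real \<Rightarrow> real^'d \<Rightarrow> real^'d) \<Rightarrow> real^'d \<Rightarrow> (nat \<Rightarrow> real^'d) \<Rightarrow> real^'d \<Rightarrow> bool" where
  "collocation_step k c h g u0 v u1 \<longleftrightarrow>
     (\<forall>i\<in>{1..k}. v i = u0 + h *\<^sub>R (\<Sum>l=1..k. collocation_a k c i l *\<^sub>R g (c l * h) (v l))) \<and>
     u1 = u0 + h *\<^sub>R (\<Sum>l=1..k. collocation_b k c l *\<^sub>R g (c l * h) (v l))"

end

theory Submission
  imports Defs
begin

text \<open>
  Every coefficient of the exponential method is a continuous function of the matrix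
  \<open>V = h A\<close>: the matrix exponential is a locally uniform limit of polynomials in \<open>V\<close>, and the
  remaining coefficients are integrals over \<open>[0, 1]\<close> of integrands that are jointly continuous in
  \<open>V\<close> and the integration variable. So the limits for \<open>A\<close> tending to \<open>0\<close> are the values at
  \<open>A = 0\<close>, and both the convergence of the coefficients and the agreement of the methods at
  \<open>A = 0\<close> come down to computing these values.

  At \<open>V = 0\<close> the exponentials become the identity, and the stage coefficient becomes, after the
  substitution \<open>y = c\<^sub>i z\<close>, the integral over \<open>[0, c\<^sub>i]\<close> of the polynomial
  \<open>b\<^sub>l (\<Sum>j<k. P\<^sub>j(c\<^sub>l) P\<^sub>j(y))\<close>, where \<open>P\<^sub>j\<close> are the orthonormal shifted Legendre
  polynomials. It remains to see that at the Gauss nodes this polynomial is the Lagrange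
  polynomial \<open>L\<close> of the node \<open>c\<^sub>l\<close> (lemma \<open>lagrange_basis_legendre_expansion\<close>). As \<open>L\<close> has degree
  below \<open>k\<close>, it is the sum of its Legendre components, so the claim is that its \<open>j\<close>-th Legendre
  coefficient is \<open>b\<^sub>l P\<^sub>j(c\<^sub>l)\<close> (lemma \<open>lagrange_legendre_coefficient\<close>). This is the
  exactness of Gauss quadrature in disguise: the polynomial \<open>L (P\<^sub>j - P\<^sub>j(c\<^sub>l))\<close> vanishes at all
  \<open>k\<close> nodes, hence is a multiple of \<open>P\<^sub>k\<close> with a cofactor of degree below \<open>k\<close>, and
  orthogonality makes its integral \<open>0\<close>.

  Orthonormality itself is derived from Rodrigues' formula by repeated integration by parts.
\<close>

section \<open>Integrals of polynomials\<close>

definition unit_integral :: "real poly \<Rightarrow> real" where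
  "unit_integral p = integral {0..1} (poly p)"

lemma poly_integrable [simp]: "poly (p :: real poly) integrable_on {a..b}"
  by (intro integrable_continuous_real continuous_intros)

lemma unit_integral_add: "unit_integral (p + q) = unit_integral p + unit_integral q"
  unfolding unit_integral_def poly_add[abs_def]
  by (subst Henstock_Kurzweil_Integration.integral_add [symmetric]) simp_all

lemma unit_integral_smult: "unit_integral (smult a p) = a * unit_integral p"
  unfolding unit_integral_def poly_smult[abs_def] by simp

lemma unit_integral_0 [simp]: "unit_integral 0 = 0"
  using unit_integral_smult[of 0 0] by simp

lemma unit_integral_sum: "unit_integral (sum f A) = (\<Sum>x\<in>A. unit_integral (f x))"
  by (induction A rule: infinite_finite_induct) (simp_all add: unit_integral_add)

lemma unit_integral_pderiv: "unit_integral (pderiv p) = poly p 1 - poly p 0"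
proof -
  have "(poly (pderiv p) has_integral (poly p 1 - poly p 0)) {0..1}"
    by (rule fundamental_theorem_of_calculus)
       (auto simp flip: has_real_derivative_iff_has_vector_derivative
             intro: DERIV_subset[OF poly_DERIV])
  then show ?thesis by (simp add: unit_integral_def integral_unique)
qed

lemma unit_integral_by_parts:
  assumes "poly (p * q) 0 = 0" "poly (p * q) 1 = 0"
  shows "unit_integral (p * pderiv q) = - unit_integral (pderiv p * q)"
  using unit_integral_pderiv[of "p * q"] assms
  by (auto simp: pderiv_mult unit_integral_add mult.commute[of q "pderiv p"])

text \<open>
  The hypothesis says exactly that all boundary terms vanish. It allows the zeros at an endpoint to
  be shared between the two factors, which the evaluation of the Beta integral in
  \<open>unit_integral_generator\<close> exploits.
\<close>
lemma unit_integral_iterated_by_parts: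
  assumes "\<And>i a. i < n \<Longrightarrow> a \<in> {0, 1} \<Longrightarrow>
    poly ((pderiv ^^ i) p * (pderiv ^^ (n - Suc i)) q) a = 0"
  shows "unit_integral (p * (pderiv ^^ n) q) = (-1) ^ n * unit_integral ((pderiv ^^ n) p * q)"
  using assms
proof (induction n arbitrary: p)
  case 0
  then show ?case by simp
next
  case (Suc n)
  have "unit_integral (p * pderiv ((pderiv ^^ n) q)) = - unit_integral (pderiv p * (pderiv ^^ n) q)"
    using Suc.prems[of 0] by (intro unit_integral_by_parts) auto
  also have "unit_integral (pderiv p * (pderiv ^^ n) q)
      = (-1) ^ n * unit_integral ((pderiv ^^ n) (pderiv p) * q)"
  proof (rule Suc.IH)
    fix i and a :: real assume "i < n" "a \<in> {0, 1}"
    then show "poly ((pderiv ^^ i) (pderiv p) * (pderiv ^^ (n - Suc i)) q) a = 0"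
      using Suc.prems[of "Suc i" a] by (simp add: funpow_swap1)
  qed
  finally show ?case by (simp add: funpow_swap1)
qed

text \<open>
  Each derivative costs at most one factor of the multiple root.
\<close>
lemma poly_higher_pderiv_eq_0:
  fixes q :: "real poly"
  assumes "[:-a, 1:] ^ n dvd q" "i < n"
  shows "poly ((pderiv ^^ i) q) a = 0"
  using assms
proof (induction i arbitrary: n q)
  case 0
  then have "[:-a, 1:] dvd q"
    by (metis dvd_power dvd_trans)
  then show ?case by (simp add: poly_eq_0_iff_dvd)
next
  case (Suc i)
  then obtain m where n: "n = Suc m" by (cases n) auto
  obtain r where q: "q = [:-a, 1:] ^ n * r" using Suc.prems by blast
  have "pderiv q = [:-a, 1:] ^ m * (smult (of_nat (Suc m)) r + [:-a, 1:] * pderiv r)"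
    unfolding q n pderiv_mult pderiv_power_Suc
    by (simp add: pderiv_pCons algebra_simps)
  then have "[:-a, 1:] ^ m dvd pderiv q" by simp
  then show ?case using Suc.IH[of m "pderiv q"] Suc.prems n by (simp add: funpow_swap1)
qed

section \<open>Legendre polynomials\<close>

text \<open>
  Rodrigues' formula. With \<open>x\<^sup>2 - x\<close> rather than \<open>x - x\<^sup>2\<close> as generator, the signs are those
  of the explicit formula for the shifted Legendre polynomials.
\<close>
definition legendre_poly :: "nat \<Rightarrow> real poly" where
  "legendre_poly n = smult (sqrt (2 * real n + 1) / fact n) ((pderiv ^^ n) ([:0, -1, 1:] ^ n))"

lemma generator_factors: "[:0, -1, 1:] ^ n = monom 1 n * [:-1, 1 :: real:] ^ n"
proof -
  have "[:0, -1, 1:] = monom 1 1 * [:-1, 1 :: real:]"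
    by (simp add: monom_altdef)
  then show ?thesis by (simp only: power_mult_distrib monom_power) simp
qed

lemma coeff_linear_power_binomial:
  "coeff ([:-1, 1 :: real:] ^ n) i = real (n choose i) * (-1) ^ (n + i)"
proof -
  have "[:-1, 1 :: real:] = monom 1 1 + [:-1:]"
    by (simp add: monom_altdef)
  then have "[:-1, 1 :: real:] ^ n = (\<Sum>k\<le>n. of_nat (n choose k) * monom 1 1 ^ k * [:-1:] ^ (n - k))"
    by (metis binomial_ring)
  also have "\<dots> = (\<Sum>k\<le>n. monom (real (n choose k) * (-1) ^ (n - k)) k)"
    by (intro sum.cong refl)
       (simp add: monom_power poly_const_pow of_nat_poly mult_monom smult_monom flip: monom_0)
  finally have "coeff ([:-1, 1 :: real:] ^ n) i
      = (\<Sum>k\<le>n. if k = i then real (n choose k) * (-1) ^ (n - k) else 0)"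
    by (simp add: coeff_sum)
  then show ?thesis
    by (simp add: binomial_eq_0 minus_one_power_iff)
qed

lemma coeff_legendre_poly:
  "coeff (legendre_poly n) i =
    (-1) ^ n * sqrt (2 * real n + 1) * (real (n choose i) * real ((n + i) choose i) * (-1) ^ i)"
proof -
  have poch: "pochhammer (real (Suc i)) n = fact (n + i) / fact i"
  proof -
    have "fact (n + i) = (pochhammer 1 (i + n) :: real)"
      by (simp add: pochhammer_fact add.commute)
    also have "\<dots> = fact i * pochhammer (real (Suc i)) n"
      using pochhammer_product'[of "1::real" i n] by (simp flip: pochhammer_fact)
    finally show ?thesis by (simp add: field_simps)
  qed
  have "real ((n + i) choose i) = fact (n + i) / (fact i * fact n)"
    by (simp add: binomial_fact)
  then have "pochhammer (real (Suc i)) n = fact n * real ((n + i) choose i)"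
    unfolding poch by simp
  then show ?thesis
    by (simp add: legendre_poly_def coeff_higher_pderiv generator_factors coeff_monom_mult
        coeff_linear_power_binomial power_add)
qed

text \<open>
  Both sides have the same coefficients once \<open>(x - 1)\<^sup>n\<close> in the generator
  \<open>x\<^sup>n (x - 1)\<^sup>n\<close> is expanded by the binomial theorem.
\<close>
lemma poly_legendre_poly: "poly (legendre_poly n) = shifted_legendre n"
proof
  fix x
  have "degree (legendre_poly n) \<le> n"
    by (rule degree_le) (simp add: coeff_legendre_poly binomial_eq_0)
  then have "poly (legendre_poly n) x = (\<Sum>i\<le>n. coeff (legendre_poly n) i * x ^ i)"
    unfolding poly_altdef by (intro sum.mono_neutral_left) (auto simp: coeff_eq_0)
  then show "poly (legendre_poly n) x = shifted_legendre n x"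
    by (simp add: shifted_legendre_def coeff_legendre_poly sum_distrib_left atMost_atLeast0
        power_minus[of x] mult_ac)
qed

lemma degree_legendre_poly: "degree (legendre_poly n) = n"
proof (rule antisym)
  show "degree (legendre_poly n) \<le> n"
    by (rule degree_le) (simp add: coeff_legendre_poly binomial_eq_0)
  have "sqrt (2 * real n + 1) > 0" by simp
  then show "n \<le> degree (legendre_poly n)"
    by (intro le_degree) (simp add: coeff_legendre_poly)
qed

lemma generator_dvd: "a \<in> {0, 1} \<Longrightarrow> [:-a, 1 :: real:] ^ n dvd [:0, -1, 1:] ^ n"
  by (auto simp: generator_factors monom_altdef)

text \<open>
  The generator vanishes to order \<open>n\<close> at both endpoints, so all \<open>n\<close> derivatives can be moved to
  the other factor.
\<close>
lemma unit_integral_Rodrigues: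
  "unit_integral (p * (pderiv ^^ n) ([:0, -1, 1:] ^ n))
    = (-1) ^ n * unit_integral ((pderiv ^^ n) p * [:0, -1, 1:] ^ n)"
proof (rule unit_integral_iterated_by_parts)
  fix i and a :: real assume *: "i < n" "a \<in> {0, 1}"
  then show "poly ((pderiv ^^ i) p * (pderiv ^^ (n - Suc i)) ([:0, -1, 1:] ^ n)) a = 0"
    using poly_higher_pderiv_eq_0[OF generator_dvd[OF *(2), of n]] by simp
qed

lemma higher_pderiv_degree_eq:
  fixes p :: "real poly"
  assumes "degree p \<le> n"
  shows "(pderiv ^^ n) p = [:fact n * coeff p n:]"
proof (rule poly_eqI)
  fix i
  show "coeff ((pderiv ^^ n) p) i = coeff [:fact n * coeff p n:] i"
    using assms
    by (cases i) (auto simp: coeff_higher_pderiv pochhammer_fact coeff_eq_0)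
qed

text \<open>
  Up to sign this is the Beta integral of \<open>x\<^sup>n (1 - x)\<^sup>n\<close>. Writing \<open>x\<^sup>n\<close> as a multiple of the
  \<open>n\<close>-th derivative of \<open>x\<^bsup>2n\<^esup>\<close> and moving the derivatives to \<open>(x - 1)\<^sup>n\<close> leaves the integral
  of \<open>x\<^bsup>2n\<^esup>\<close>.
\<close>
lemma unit_integral_generator:
  "unit_integral ([:0, -1, 1:] ^ n) = (-1) ^ n * fact n * fact n / fact (2 * n + 1)"
proof -
  \<comment> \<open>At 0 the monomial has a zero of order 2n, at 1 the other factor has one of order n.\<close>
  have zero: "poly ((pderiv ^^ i) ([:-1, 1:] ^ n) * (pderiv ^^ (n - Suc i)) (monom 1 (2 * n))) a = 0"
    if "i < n" "a \<in> {0, 1}" for i and a :: real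
  proof (cases "a = 0")
    case True
    have "[:-0, 1 :: real:] ^ (2 * n) dvd monom 1 (2 * n)"
      by (simp add: monom_altdef)
    then show ?thesis using poly_higher_pderiv_eq_0[of 0 "2 * n"] that True by auto
  next
    case False
    then show ?thesis using that poly_higher_pderiv_eq_0[of 1 n "[:-1, 1:] ^ n" i] by auto
  qed
  have "pochhammer (real n + 1) n * fact n = fact (2 * n)"
    using pochhammer_product'[of "1 :: real" n n]
    by (simp add: pochhammer_fact mult_2 [of n] add.commute mult.commute [of _ "pochhammer 1 n"])
  then have "pochhammer (real n + 1) n = fact (2 * n) / fact n"
    by (simp add: field_simps)
  then have D: "(pderiv ^^ n) (monom 1 (2 * n)) = smult (fact (2 * n) / fact n) (monom (1::real) n)"
    by (intro poly_eqI) (auto simp: coeff_higher_pderiv add.commute mult_2)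
  have "degree ([:-1, 1 :: real:] ^ n) \<le> n"
    by (simp add: degree_power_eq)
  then have "(pderiv ^^ n) ([:-1, 1 :: real:] ^ n) = [:fact n:]"
    by (simp add: higher_pderiv_degree_eq coeff_linear_power)
  then have "unit_integral ([:-1, 1:] ^ n * (pderiv ^^ n) (monom 1 (2 * n)))
      = (-1) ^ n * fact n * unit_integral (monom 1 (2 * n))"
    by (subst unit_integral_iterated_by_parts[OF zero]) (simp_all add: unit_integral_smult)
  moreover have "unit_integral (monom 1 (2 * n)) = 1 / (2 * real n + 1)"
  proof -
    have "pderiv (monom (1 / (2 * real n + 1)) (2 * n + 1)) = monom 1 (2 * n)"
      by (simp add: pderiv_monom)
    then have "unit_integral (monom 1 (2 * n)) = unit_integral (pderiv (monom (1 / (2 * real n + 1)) (2 * n + 1)))"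
      by simp
    also have "\<dots> = 1 / (2 * real n + 1)"
      unfolding unit_integral_pderiv by (simp add: poly_monom)
    finally show ?thesis .
  qed
  ultimately have "fact (2 * n) / fact n * unit_integral ([:0, -1, 1:] ^ n)
      = (-1) ^ n * fact n / (2 * real n + 1)"
    by (simp add: D unit_integral_smult generator_factors mult.commute[of "monom 1 n"])
  moreover have "fact (2 * n + 1) = (2 * real n + 1) * fact (2 * n)"
    by simp
  moreover have "2 * real n + 1 \<noteq> 0"
    by linarith
  ultimately show ?thesis
    by (simp only:) (simp add: divide_simps mult_ac)
qed

lemma legendre_poly_orthogonal_lower_degree:
  assumes "degree q < n"
  shows "unit_integral (q * legendre_poly n) = 0"
  using assms
  by (simp add: legendre_poly_def unit_integral_smult unit_integral_Rodrigues
      higher_pderiv_degree_eq coeff_eq_0)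

text \<open>
  Moving the \<open>n\<close> derivatives of one factor to the other turns the latter into a constant, which
  leaves the integral of the generator. The factor \<open>sqrt (2 n + 1)\<close> is what normalises the result.
\<close>
lemma unit_integral_legendre_poly_square:
  "unit_integral (legendre_poly n * legendre_poly n) = 1"
proof -
  define s where "s = sqrt (2 * real n + 1)"
  have s: "s * s = 2 * real n + 1" by (simp add: s_def)
  have D: "(pderiv ^^ n) (legendre_poly n) = [:s * fact (2 * n) / fact n:]"
  proof -
    have "real ((n + n) choose n) = fact (2 * n) / (fact n * fact n)"
      by (simp add: binomial_fact mult_2)
    then show ?thesis
      by (simp add: higher_pderiv_degree_eq degree_legendre_poly coeff_legendre_poly s_def
          flip: power_add)
  qed
  have "unit_integral (legendre_poly n * legendre_poly n)
      = s / fact n * unit_integral (legendre_poly n * (pderiv ^^ n) ([:0, -1, 1:] ^ n))"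
    by (subst (2) legendre_poly_def) (simp add: unit_integral_smult s_def)
  also have "\<dots> = s / fact n * ((-1) ^ n * (s * fact (2 * n) / fact n * unit_integral ([:0, -1, 1:] ^ n)))"
    by (simp add: unit_integral_Rodrigues D unit_integral_smult)
  also have "\<dots> = s * s * fact (2 * n) / fact (2 * n + 1) * ((-1) ^ n * (-1) ^ n)"
    by (simp add: unit_integral_generator field_simps)
  also have "\<dots> = 1"
    by (simp add: s flip: power_add)
  finally show ?thesis .
qed

lemma unit_integral_legendre_poly_mult:
  "unit_integral (legendre_poly i * legendre_poly j) = (if i = j then 1 else 0)"
  using legendre_poly_orthogonal_lower_degree[of "legendre_poly i" j]
    legendre_poly_orthogonal_lower_degree[of "legendre_poly j" i]
    unit_integral_legendre_poly_square[of i]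
  by (cases i j rule: linorder_cases) (auto simp: degree_legendre_poly mult.commute)

text \<open>
  Subtracting a multiple of \<open>legendre_poly n\<close> removes the coefficient of \<open>x\<^sup>n\<close>. The degree bound is
  stated through coefficients so that \<open>n = 0\<close> means the zero polynomial.
\<close>
lemma ex_legendre_expansion:
  assumes "\<And>i. i \<ge> n \<Longrightarrow> coeff p i = 0"
  shows "\<exists>a. p = (\<Sum>j<n. smult (a j) (legendre_poly j))"
  using assms
proof (induction n arbitrary: p)
  case 0
  then have "p = 0" by (intro poly_eqI) auto
  then show ?case by simp
next
  case (Suc n)
  define t where "t = coeff p n / coeff (legendre_poly n) n"
  have nz: "coeff (legendre_poly n) n \<noteq> 0"
  proof -
    have "sqrt (2 * real n + 1) > 0" by simp
    then show ?thesis by (simp add: coeff_legendre_poly)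
  qed
  have "\<exists>a. p - smult t (legendre_poly n) = (\<Sum>j<n. smult (a j) (legendre_poly j))"
  proof (rule Suc.IH)
    fix i assume "i \<ge> n"
    then show "coeff (p - smult t (legendre_poly n)) i = 0"
      using Suc.prems[of i] nz
      by (cases "i = n") (auto simp: t_def coeff_eq_0 degree_legendre_poly)
  qed
  then obtain a where "p - smult t (legendre_poly n) = (\<Sum>j<n. smult (a j) (legendre_poly j))"
    by blast
  then have "p = (\<Sum>j<Suc n. smult ((a(n := t)) j) (legendre_poly j))"
    by (simp add: algebra_simps)
  then show ?case by blast
qed

lemma legendre_expansion:
  assumes "degree p < n"
  shows "p = (\<Sum>j<n. smult (unit_integral (p * legendre_poly j)) (legendre_poly j))"
proof -
  obtain a where a: "p = (\<Sum>j<n. smult (a j) (legendre_poly j))"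
    using ex_legendre_expansion[of n p] assms by (auto simp: coeff_eq_0)
  have "unit_integral (p * legendre_poly i) = a i" if "i < n" for i
    using that
    by (subst a) (simp add: sum_distrib_right unit_integral_sum unit_integral_smult
        unit_integral_legendre_poly_mult if_distrib cong: if_cong)
  then show ?thesis using a by simp
qed

section \<open>Lagrange polynomials at the Gauss nodes\<close>

lemma prod_linear_dvd:
  fixes p :: "real poly"
  assumes "finite S" "\<And>x. x \<in> S \<Longrightarrow> poly p x = 0"
  shows "(\<Prod>x\<in>S. [:-x, 1:]) dvd p"
  using assms
proof (induction S rule: finite_induct)
  case empty
  then show ?case by simp
next
  case (insert x S)
  then obtain r where r: "p = (\<Prod>x\<in>S. [:-x, 1:]) * r" by auto
  have "poly (\<Prod>x\<in>S. [:-x, 1:]) x \<noteq> 0"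
    using insert.hyps by (auto simp: poly_prod)
  then have "poly r x = 0"
    using insert.prems[of x] by (simp add: r)
  then have "[:-x, 1:] dvd r" by (simp add: poly_eq_0_iff_dvd)
  then show ?case using insert.hyps by 
    (simp add: r mult_dvd_mono mult.commute del: mult_pCons_left mult_pCons_right)
qed

text \<open>
  The roots of \<open>w\<close> in \<open>S\<close> are as many as its degree allows, so \<open>w\<close> is a constant multiple of the
  product of the corresponding linear factors, and this product divides \<open>p\<close>.
\<close>
lemma dvd_of_common_simple_roots:
  fixes p w :: "real poly"
  assumes "finite S" "card S = degree w" "w \<noteq> 0"
    and "\<And>x. x \<in> S \<Longrightarrow> poly w x = 0" "\<And>x. x \<in> S \<Longrightarrow> poly p x = 0"
  shows "w dvd p"
proof -
  define m where "m = (\<Prod>x\<in>S. [:-x, 1:])"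
  have "degree m = card S"
    unfolding m_def by (subst degree_prod_sum_eq) auto
  obtain r where r: "w = m * r"
    using prod_linear_dvd[OF assms(1,4)] unfolding m_def by blast
  then have "degree r = 0" "r \<noteq> 0"
    using assms(2,3) \<open>degree m = card S\<close> by (auto simp: degree_mult_eq)
  then have "w dvd m"
    unfolding r using mult_dvd_mono[of m m r 1] by (simp add: is_unit_iff_degree)
  also have "m dvd p"
    unfolding m_def by (rule prod_linear_dvd[OF assms(1,5)])
  finally show ?thesis .
qed

definition lagrange_poly :: "nat \<Rightarrow> (nat \<Rightarrow> real) \<Rightarrow> nat \<Rightarrow> real poly" where
  "lagrange_poly k c l = (\<Prod>m\<in>{1..k} - {l}. smult (1 / (c l - c m)) [:-c m, 1:])"

lemma poly_lagrange_poly: "poly (lagrange_poly k c l) = lagrange_basis k c l"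
  by (rule ext) (simp add: lagrange_poly_def lagrange_basis_def poly_prod diff_divide_distrib)

lemma degree_lagrange_poly:
  assumes "l \<in> {1..k}"
  shows "degree (lagrange_poly k c l) < k"
proof -
  have "degree (lagrange_poly k c l)
      \<le> (\<Sum>m\<in>{1..k} - {l}. degree (smult (1 / (c l - c m)) [:-c m, 1:]))"
    unfolding lagrange_poly_def by (rule degree_prod_sum_le[unfolded o_def]) simp
  also have "\<dots> \<le> (\<Sum>m\<in>{1..k} - {l}. 1)"
    by (intro sum_mono) (simp add: degree_pCons_eq)
  also have "\<dots> < k" using assms by simp
  finally show ?thesis .
qed

lemma lagrange_basis_other_node:
  assumes "m \<in> {1..k}" "m \<noteq> l"
  shows "lagrange_basis k c l (c m) = 0"
  using assms by (auto simp: lagrange_basis_def intro!: prod_zero)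

text \<open>
  Replacing \<open>legendre_poly j\<close> by its value at the node \<open>c l\<close> changes the integrand by a polynomial
  that vanishes at all nodes: at \<open>c l\<close> because of the second factor, elsewhere because of the
  Lagrange polynomial. That polynomial is a multiple of \<open>legendre_poly k\<close> with a cofactor of
  degree below \<open>k\<close>, so its integral is \<open>0\<close>. What is left is the integral of the Lagrange polynomial,
  the weight \<open>b l\<close>, times the value at the node.
\<close>
lemma lagrange_legendre_coefficient:
  assumes gauss: "gauss_legendre_quadrature k c b" and l: "l \<in> {1..k}" and "j < k"
  shows "unit_integral (lagrange_poly k c l * legendre_poly j) = b l * shifted_legendre j (c l)"
proof -
  let ?L = "lagrange_poly k c l" and ?e = "shifted_legendre j (c l)"
  define r where "r = ?L * (legendre_poly j - [:?e:])"
  have inj: "inj_on c {1..k}" and root: "\<And>m. m \<in> {1..k} \<Longrightarrow> shifted_legendre k (c m) = 0"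
    and b: "b l = unit_integral ?L"
    using gauss l by (auto simp: gauss_legendre_quadrature_def unit_integral_def poly_lagrange_poly)
  have "legendre_poly k \<noteq> 0" using degree_legendre_poly[of k] \<open>j < k\<close> by auto
  have "legendre_poly k dvd r"
  proof (rule dvd_of_common_simple_roots[of "c ` {1..k}"])
    show "card (c ` {1..k}) = degree (legendre_poly k)"
      by (subst card_image[OF inj]) (simp add: degree_legendre_poly)
    show "poly r x = 0" if "x \<in> c ` {1..k}" for x
      using that lagrange_basis_other_node[of _ k l c]
      by (force simp: r_def poly_lagrange_poly poly_legendre_poly)
  qed (use root \<open>legendre_poly k \<noteq> 0\<close> in \<open>auto simp: poly_legendre_poly\<close>)
  then obtain q where q: "r = q * legendre_poly k" by (metis dvd_def mult.commute)
  have "degree r \<le> degree ?L + degree (legendre_poly j - [:?e:])"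
    unfolding r_def by (rule degree_mult_le)
  also have "degree (legendre_poly j - [:?e:]) \<le> j"
    by (rule degree_diff_le) (simp_all add: degree_legendre_poly)
  finally have "degree r < 2 * k"
    using degree_lagrange_poly[OF l, of c] \<open>j < k\<close> by simp
  then have "degree q < k"
    using \<open>legendre_poly k \<noteq> 0\<close> \<open>j < k\<close>
    by (cases "q = 0") (auto simp: q degree_mult_eq degree_legendre_poly)
  then have "unit_integral r = 0"
    unfolding q by (rule legendre_poly_orthogonal_lower_degree)
  moreover have "?L * legendre_poly j = r + smult ?e ?L"
    by (simp add: r_def algebra_simps)
  ultimately show ?thesis by (simp add: unit_integral_add unit_integral_smult b)
qed

text \<open>
  In terms of the Christoffel-Darboux kernel \<open>K(x, y) = (\<Sum>j<k. P\<^sub>j(x) P\<^sub>j(y))\<close>, the Lagrange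
  basis at the Gauss nodes consists of the kernel sections \<open>K(c\<^sub>l, \<cdot>)\<close>, scaled by the weights.
\<close>
lemma lagrange_basis_legendre_expansion:
  assumes "gauss_legendre_quadrature k c b" "l \<in> {1..k}"
  shows "lagrange_basis k c l x = b l * (\<Sum>j<k. shifted_legendre j (c l) * shifted_legendre j x)"
proof -
  have "poly (lagrange_poly k c l) x = (\<Sum>j<k. b l * shifted_legendre j (c l) * shifted_legendre j x)"
    by (subst legendre_expansion[OF degree_lagrange_poly[OF assms(2)]])
       (simp add: poly_sum lagrange_legendre_coefficient[OF assms] poly_legendre_poly)
  then show ?thesis by (simp add: poly_lagrange_poly sum_distrib_left mult.assoc)
qed

text \<open>
  The form without division by \<open>x\<close> also covers \<open>x = 0\<close>.
\<close>
lemma integral_stretch_unit: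
  fixes f :: "real \<Rightarrow> real"
  assumes "0 \<le> x" "continuous_on {0..x} f"
  shows "x * integral {0..1} (\<lambda>z. f (x * z)) = integral {0..x} f"
proof -
  have "((\<lambda>z. x *\<^sub>R f (x * z)) has_integral integral {x * 0..x * 1} f) {0..1}"
    using assms
    by (intro has_integral_substitution[where c = 0 and d = x])
       (auto intro!: derivative_eq_intros mult_left_le)
  from integral_unique[OF this] show ?thesis by simp
qed

lemma continuous_on_shifted_legendre [continuous_intros]:
  "continuous_on S f \<Longrightarrow> continuous_on S (\<lambda>x. shifted_legendre j (f x))"
  unfolding poly_legendre_poly[symmetric] by (intro continuous_intros)

text \<open>
  The left-hand side is the scalar that remains of a method coefficient when the matrix vanishes:
  \<open>x\<close> is a node for the stages and \<open>1\<close> for the update.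
\<close>
lemma collocation_integral_legendre_sum:
  assumes "gauss_legendre_quadrature k c b" "l \<in> {1..k}" "0 \<le> x"
  shows "x * b l * (\<Sum>j<k. shifted_legendre j (c l) * integral {0..1} (\<lambda>z. shifted_legendre j (x * z)))
    = integral {0..x} (lagrange_basis k c l)"
proof -
  have int: "shifted_legendre j integrable_on {0..x}" for j
    by (simp flip: poly_legendre_poly)
  have "x * b l * (\<Sum>j<k. shifted_legendre j (c l) * integral {0..1} (\<lambda>z. shifted_legendre j (x * z)))
    = b l * (\<Sum>j<k. shifted_legendre j (c l) * (x * integral {0..1} (\<lambda>z. shifted_legendre j (x * z))))"
    by (simp add: sum_distrib_left mult_ac)
  also have "\<dots> = b l * (\<Sum>j<k. shifted_legendre j (c l) * integral {0..x} (shifted_legendre j))"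
    using \<open>0 \<le> x\<close> by (subst integral_stretch_unit) (auto intro!: continuous_intros)
  also have "\<dots> = integral {0..x} (\<lambda>y. b l * (\<Sum>j<k. shifted_legendre j (c l) * shifted_legendre j y))"
    by (simp add: integral_sum integrable_on_mult_right int)
  also have "\<dots> = integral {0..x} (lagrange_basis k c l)"
    by (intro integral_cong) (simp add: lagrange_basis_legendre_expansion[OF assms(1,2)])
  finally show ?thesis .
qed

section \<open>Continuity of the matrix coefficients\<close>

lemma bounded_bilinear_matrix_mult:
  "bounded_bilinear ((**) :: real^'d^'d \<Rightarrow> real^'d^'d \<Rightarrow> real^'d^'d)"
proof (rule bilinear_conv_bounded_bilinear[THEN iffD1])
  show "bilinear ((**) :: real^'d^'d \<Rightarrow> real^'d^'d \<Rightarrow> real^'d^'d)"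
    unfolding bilinear_def
    by (intro conjI allI linearI)
       (vector matrix_matrix_mult_def sum.distrib[symmetric] sum_distrib_left field_simps)+
qed

lemma matrix_power_simps [simp]:
  "matrix_power Z 0 = mat 1"
  "matrix_power Z (Suc m) = Z ** matrix_power Z m"
  by (simp_all add: matrix_power_def)

text \<open>
  Any bound \<open>K\<close> of the bilinear matrix product suffices: the exponential series can then be
  compared with the scalar one at \<open>K * norm Z\<close>, which converges everywhere.
\<close>
lemma norm_matrix_power_le:
  "\<exists>K>0. \<forall>(Z::real^'d^'d) m. norm (matrix_power Z m) \<le> norm (mat 1 :: real^'d^'d) * (K * norm Z) ^ m"
proof -
  obtain K where K: "K > 0" "\<And>(A :: real^'d^'d) (B :: real^'d^'d). norm (A ** B) \<le> norm A * norm B * K"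
    using bounded_bilinear.pos_bounded[OF bounded_bilinear_matrix_mult[where ?'d = 'd]] by blast
  have "norm (matrix_power Z m) \<le> norm (mat 1 :: real^'d^'d) * (K * norm Z) ^ m" for Z :: "real^'d^'d" and m
  proof (induction m)
    case 0
    then show ?case by simp
  next
    case (Suc m)
    have "norm (matrix_power Z (Suc m)) \<le> (K * norm Z) * norm (matrix_power Z m)"
      using K(2)[of Z "matrix_power Z m"] by (simp add: mult_ac)
    also have "\<dots> \<le> (K * norm Z) * (norm (mat 1 :: real^'d^'d) * (K * norm Z) ^ m)"
      using K(1) by (intro mult_left_mono Suc.IH) simp
    finally show ?case by (simp add: mult_ac)
  qed
  with K(1) show ?thesis by blast
qed

lemma continuous_on_matrix_power: "continuous_on S (\<lambda>Z. matrix_power Z m)"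
  by (induction m)
     (auto intro!: bounded_bilinear.continuous_on[OF bounded_bilinear_matrix_mult] continuous_intros)

text \<open>
  On every ball the exponential series converges uniformly by comparison with a scalar one.
\<close>
lemma continuous_on_matrix_exp_UNIV: "continuous_on UNIV (matrix_exp :: real^'d^'d \<Rightarrow> _)"
proof -
  obtain K where K: "K > 0"
    "\<And>(Z::real^'d^'d) m. norm (matrix_power Z m) \<le> norm (mat 1 :: real^'d^'d) * (K * norm Z) ^ m"
    using norm_matrix_power_le by blast
  have "continuous_on (ball 0 r) (matrix_exp :: real^'d^'d \<Rightarrow> _)" for r
  proof (rule uniform_limit_theorem)
    show "uniform_limit (ball 0 r) (\<lambda>n Z :: real^'d^'d. \<Sum>m<n. (1 / fact m) *\<^sub>R matrix_power Z m)
        matrix_exp sequentially"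
      unfolding matrix_exp_def[abs_def]
    proof (rule Weierstrass_m_test)
      fix m and Z :: "real^'d^'d" assume Z: "Z \<in> ball 0 r"
      have "norm (matrix_power Z m) \<le> norm (mat 1 :: real^'d^'d) * (K * norm Z) ^ m" by (rule K(2))
      also have "\<dots> \<le> norm (mat 1 :: real^'d^'d) * (K * r) ^ m"
        using Z K(1) by (intro mult_left_mono power_mono) auto
      finally show "norm ((1 / fact m) *\<^sub>R matrix_power Z m)
          \<le> norm (mat 1 :: real^'d^'d) * ((K * r) ^ m /\<^sub>R fact m)"
        by (simp add: divide_simps)
    next
      show "summable (\<lambda>m. norm (mat 1 :: real^'d^'d) * ((K * r) ^ m /\<^sub>R fact m))"
        by (intro summable_mult summable_exp_generic)
    qed
  qed (auto intro!: always_eventually continuous_intros continuous_on_matrix_power)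
  then have "continuous (at Z) matrix_exp" for Z :: "real^'d^'d"
    by (rule continuous_on_interior[of "ball 0 (norm Z + 1)"]) simp
  then show ?thesis by (simp add: continuous_on_eq_continuous_at)
qed

lemmas continuous_on_matrix_exp [continuous_intros] =
  continuous_on_compose2[OF continuous_on_matrix_exp_UNIV _ subset_UNIV]

lemma matrix_exp_0 [simp]: "matrix_exp (0 :: real^'d^'d) = mat 1"
proof -
  have "matrix_power (0 :: real^'d^'d) m = (if m = 0 then mat 1 else 0)" for m
    by (cases m) (simp_all add: matrix_matrix_mult_def vec_eq_iff)
  then have "(\<lambda>m. (1 / fact m) *\<^sub>R matrix_power (0 :: real^'d^'d) m) = (\<lambda>m. if m = 0 then mat 1 else 0)"
    by auto
  then show ?thesis
    unfolding matrix_exp_def using sums_unique[OF sums_single[of 0 "\<lambda>_. mat 1 :: real^'d^'d"]] by simp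
qed

lemma continuous_on_I_stage [continuous_intros]:
  "continuous_on UNIV (I_stage j x :: real^'d^'d \<Rightarrow> _)"
  unfolding I_stage_def[abs_def] box_real(2)[symmetric]
  by (rule integral_continuous_on_param) (auto simp: case_prod_beta intro!: continuous_intros)

lemma I_update_eq_I_stage: "I_update j = I_stage j 1"
  by (simp add: fun_eq_iff I_update_def I_stage_def)

lemma I_stage_0: "I_stage j x 0 = integral {0..1} (\<lambda>z. shifted_legendre j (x * z)) *\<^sub>R mat 1"
proof -
  have "(\<lambda>z. shifted_legendre j (x * z)) integrable_on {0..1}"
    by (intro integrable_continuous_real continuous_intros)
  then show ?thesis by (simp add: I_stage_def integrable_integral has_integral_scaleR_left integral_unique)
qed

lemma continuous_on_efcm_a: "continuous_on UNIV (\<lambda>V::real^'d^'d. efcm_a n c b V i l)"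
  unfolding efcm_a_def by (intro continuous_intros)

lemma continuous_on_efcm_b: "continuous_on UNIV (\<lambda>V::real^'d^'d. efcm_b n c b V l)"
  unfolding efcm_b_def I_update_eq_I_stage by (intro continuous_intros)

section \<open>The limit of vanishing linear part\<close>

lemma efcm_a_0:
  assumes "gauss_legendre_quadrature k c b" "i \<in> {1..k}" "l \<in> {1..k}"
  shows "efcm_a k c b 0 i l = collocation_a k c i l *\<^sub>R mat 1"
proof -
  have "0 \<le> c i" using assms(1,2) by (auto simp: gauss_legendre_quadrature_def)
  from collocation_integral_legendre_sum[OF assms(1,3) this] show ?thesis
    by (simp add: efcm_a_def I_stage_0 collocation_a_def flip: scaleR_sum_left)
qed

lemma efcm_b_0:
  assumes "gauss_legendre_quadrature k c b" "l \<in> {1..k}"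
  shows "efcm_b k c b 0 l = collocation_b k c l *\<^sub>R mat 1"
  using collocation_integral_legendre_sum[OF assms, of 1]
  by (simp add: efcm_b_def I_update_eq_I_stage I_stage_0 collocation_b_def flip: scaleR_sum_left)

lemma tendsto_at_0_scaled:
  fixes F :: "'a::real_normed_vector \<Rightarrow> 'b::topological_space"
  assumes "continuous_on UNIV F"
  shows "((\<lambda>A. F (t *\<^sub>R A)) \<longlongrightarrow> F 0) (at 0)"
proof -
  have "continuous_on UNIV (\<lambda>A. F (t *\<^sub>R A))"
    by (rule continuous_on_compose2[OF assms]) (auto intro!: continuous_intros)
  then have "((\<lambda>A. F (t *\<^sub>R A)) \<longlongrightarrow> F (t *\<^sub>R 0)) (at 0)"
    unfolding continuous_on_def by (rule bspec) simp
  then show ?thesis by simp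
qed


theorem theorem3p2:
  fixes k :: nat and c b :: "nat \<Rightarrow> real" and h :: real
    and g :: "real \<Rightarrow> real^'d \<Rightarrow> real^'d" and u0 :: "real^'d"
  assumes "k \<ge> 2"
    and "gauss_legendre_quadrature k c b"
    and "h > 0"
    and "real_analytic (\<lambda>(t, u). g t u)"
  shows "(\<forall>i\<in>{1..k}. ((\<lambda>A::real^'d^'d. phi 0 (- c i *\<^sub>R (h *\<^sub>R A))) \<longlongrightarrow> mat 1) (at 0)) \<and>
    (\<forall>i\<in>{1..k}. \<forall>l\<in>{1..k}.
       ((\<lambda>A::real^'d^'d. efcm_a k c b (h *\<^sub>R A) i l) \<longlongrightarrow> collocation_a k c i l *\<^sub>R mat 1) (at 0)) \<and>
    ((\<lambda>A::real^'d^'d. phi 0 (- (h *\<^sub>R A))) \<longlongrightarrow> mat 1) (at 0) \<and>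
    (\<forall>l\<in>{1..k}.
       ((\<lambda>A::real^'d^'d. efcm_b k c b (h *\<^sub>R A) l) \<longlongrightarrow> collocation_b k c l *\<^sub>R mat 1) (at 0)) \<and>
    (\<forall>v u1. efcm_step k k c b h 0 g u0 v u1 \<longleftrightarrow> collocation_step k c h g u0 v u1)"
proof -
  note gauss = assms(2)
  have phi0: "((\<lambda>A::real^'d^'d. phi 0 (t *\<^sub>R A)) \<longlongrightarrow> mat 1) (at 0)" for t
    using tendsto_at_0_scaled[OF continuous_on_matrix_exp_UNIV, of t] by (simp add: phi_def)
  have "efcm_step k k c b h 0 g u0 v u1 \<longleftrightarrow> collocation_step k c h g u0 v u1" for v u1
    by (simp add: efcm_step_def collocation_step_def phi_def efcm_a_0[OF gauss] efcm_b_0[OF gauss]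
        flip: scaleR_matrix_vector_assoc)
  moreover have "((\<lambda>A::real^'d^'d. efcm_a k c b (h *\<^sub>R A) i l) \<longlongrightarrow> collocation_a k c i l *\<^sub>R mat 1) (at 0)"
    if "i \<in> {1..k}" "l \<in> {1..k}" for i l
    using tendsto_at_0_scaled[OF continuous_on_efcm_a] by (simp flip: efcm_a_0[OF gauss that])
  moreover have "((\<lambda>A::real^'d^'d. efcm_b k c b (h *\<^sub>R A) l) \<longlongrightarrow> collocation_b k c l *\<^sub>R mat 1) (at 0)"
    if "l \<in> {1..k}" for l
    using tendsto_at_0_scaled[OF continuous_on_efcm_b] by (simp flip: efcm_b_0[OF gauss that])
  ultimately show ?thesis
    using phi0[of "- h"] by (auto intro!: phi0[of "- c _ * h", simplified])
qed

end
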